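(* Let $\Omega$ be a compact topological space and $\mathcal{E}$ a Banach space. A family $\{T_\omega\}_{\omega\in\Omega}$ of contractive $C_0$-semigroups on $\mathcal{E}$ is $k_{\mathrm{SOT}}$-continuous in the index set if and only if there exists a (necessarily unique) contractive $C_0$-semigroup $T_\Omega$ on $\mathcal{E}_\Omega$ satisfying $$\pi_\omega\,T_\Omega(t)=T_\omega(t)\,\pi_\omega,\qquad\text{and thus}\qquad\pi_\omega\,T_\Omega(t)\,\boldsymbol{\iota}=T_\omega(t),$$ for all $\omega\in\Omega$ and $t\in\mathbb{R}_{\ge 0}$.
   Context: $\mathcal{E}_\Omega=C(\Omega,\mathcal{E})$ is the Banach space of continuous functions $\Omega\to\mathcal{E}$ with norm $\|f\|_\Omega=\sup_{\omega\in\Omega}\|f(\omega)\|$. The isometric embedding $\boldsymbol{\iota}:\mathcal{E}\to\mathcal{E}_\Omega$ is $(\boldsymbol{\iota}\,\xi)(\omega)=\xi$, and for $\omega\in\Omega$ the surjective contraction $\pi_\omega:\mathcal{E}_\Omega\to\mathcal{E}$ is $\pi_\omega f=f(\omega)$. $\{T_\omega\}_{\omega\in\Omega}$ is $k_{\mathrm{SOT}}$-continuous in the index set if for every $\omega_0\in\Omega$, every compact $K\subseteq\mathbb{R}_{\ge 0}$ and every $\xi\in\mathcal{E}$ one has $\sup_{t\in K}\|(T_\omega(t)-T_{\omega_0}(t))\xi\|\to0$ as $\omega\to\omega_0$. *)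

theory Defs
  imports "HOL-Analysis.Analysis"
begin

text \<open>
  The space \<open>C(\<Omega>, E)\<close> with the supremum norm is the library type of bounded continuous
  functions; if \<open>\<Omega>\<close> is compact, boundedness is automatic:
\<close>

lemma bcontfun_compact_eq:
  assumes "compact (UNIV :: 'w::topological_space set)"
  shows "(bcontfun :: ('w \<Rightarrow> 'e::real_normed_vector) set) = {f. continuous_on UNIV f}"
  using assms by (auto simp: bcontfun_def intro: compact_imp_bounded compact_continuous_image)

lemma norm_bcontfun_eq_SUP:
  fixes f :: "'w::topological_space \<Rightarrow>\<^sub>C 'e::real_normed_vector"
  shows "norm f = (SUP \<omega>. norm (apply_bcontfun f \<omega>))"
  by (simp add: norm_bcontfun_def dist_bcontfun.rep_eq)

lift_definition const_embedding ::
    "'e::real_normed_vector \<Rightarrow>\<^sub>L ('w::topological_space \<Rightarrow>\<^sub>C 'e)" is const_bcontfun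
  by (rule bounded_linear_intro[where K = 1])
    (auto intro!: bcontfun_eqI norm_bound simp: const_bcontfun.rep_eq)

lift_definition point_eval ::
    "'w::topological_space \<Rightarrow> ('w \<Rightarrow>\<^sub>C 'e::real_normed_vector) \<Rightarrow>\<^sub>L 'e"
  is "\<lambda>\<omega> f. apply_bcontfun f \<omega>"
  by (rule bounded_linear_intro[where K = 1]) (auto simp: norm_bounded)

text \<open>
  One-parameter semigroups are indexed by \<^typ>\<open>real\<close>; only their values at \<open>t \<ge> 0\<close> are
  meaningful.
\<close>

definition C0_semigroup :: "(real \<Rightarrow> 'a::real_normed_vector \<Rightarrow>\<^sub>L 'a) \<Rightarrow> bool" where
  "C0_semigroup T \<longleftrightarrow>
     T 0 = id_blinfun \<and>
     (\<forall>s\<ge>0. \<forall>t\<ge>0. T (s + t) = T s o\<^sub>L T t) \<and>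
     (\<forall>\<xi>. continuous_on {0..} (\<lambda>t. blinfun_apply (T t) \<xi>))"

definition contractive_C0_semigroup ::
    "(real \<Rightarrow> 'a::real_normed_vector \<Rightarrow>\<^sub>L 'a) \<Rightarrow> bool" where
  "contractive_C0_semigroup T \<longleftrightarrow> C0_semigroup T \<and> (\<forall>t\<ge>0. norm (T t) \<le> 1)"

text \<open>
  The empty compact set is excluded below because the supremum of the empty set of reals is
  unspecified in HOL. For strongly continuous families the suprema are over bounded sets.
\<close>

definition kSOT_continuous ::
    "('w::topological_space \<Rightarrow> real \<Rightarrow> 'e::real_normed_vector \<Rightarrow>\<^sub>L 'e) \<Rightarrow> bool" where
  "kSOT_continuous T \<longleftrightarrow>
     (\<forall>\<omega>0 K \<xi>. compact K \<and> K \<noteq> {} \<and> K \<subseteq> {0..} \<longrightarrow>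
        ((\<lambda>\<omega>. SUP t\<in>K. norm (blinfun_apply (T \<omega> t - T \<omega>0 t) \<xi>)) \<longlongrightarrow> 0) (at \<omega>0))"

definition intertwines ::
    "('w::topological_space \<Rightarrow> real \<Rightarrow> 'e::real_normed_vector \<Rightarrow>\<^sub>L 'e) \<Rightarrow>
     (real \<Rightarrow> ('w \<Rightarrow>\<^sub>C 'e) \<Rightarrow>\<^sub>L ('w \<Rightarrow>\<^sub>C 'e)) \<Rightarrow> bool" where
  "intertwines T S \<longleftrightarrow>
     (\<forall>\<omega>. \<forall>t\<ge>0. point_eval \<omega> o\<^sub>L S t = T \<omega> t o\<^sub>L point_eval \<omega>)"

end

theory Submission
  imports Defs
begin

text \<open>
  Intertwining with every \<open>\<pi>\<^sub>\<omega>\<close> says exactly that \<open>(S t f)(\<omega>) = T \<omega> t (f \<omega>)\<close>. This formula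
  determines \<open>S t\<close>, which gives uniqueness, and on constant functions it gives
  \<open>\<pi>\<^sub>\<omega> S(t) \<iota> = T\<^sub>\<omega>(t)\<close>. What remains is to compare the continuity requirements: the formula must
  produce continuous functions of \<open>\<omega>\<close>, and the orbits \<open>t \<mapsto> S t f\<close> must be continuous for the
  supremum norm. Both directions exchange a uniformity in \<open>\<omega>\<close> for a uniformity in \<open>t\<close> by a
  compactness argument.

  If \<open>T\<close> is continuous in the index, contractivity allows \<open>f \<omega>\<close> to be replaced by \<open>f \<omega>\<^sub>0\<close> for
  \<open>\<omega>\<close> near \<open>\<omega>\<^sub>0\<close>. Hence \<open>S t f\<close> is continuous, and \<open>t \<mapsto> T \<omega> t (f \<omega>)\<close> stays close, on bounded
  time intervals, to the continuous orbit \<open>t \<mapsto> T \<omega>\<^sub>0 t (f \<omega>\<^sub>0)\<close>. Finitely many such neighbourhoods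
  cover \<open>\<Omega>\<close>, so the orbit of \<open>f\<close> is continuous uniformly in \<open>\<omega>\<close>
  (lemma \<open>fibrewise_strongly_continuous\<close>).

  Conversely, an orbit \<open>t \<mapsto> S t (\<iota> \<xi>)\<close> maps a compact \<open>K\<close> to a compact, hence equicontinuous,
  set of functions of \<open>\<omega>\<close> (lemma \<open>compact_bcontfun_equicontinuous\<close>); equicontinuity at
  \<open>\<omega>\<^sub>0\<close> is the required convergence, uniform for \<open>t\<close> in \<open>K\<close>.
\<close>

section \<open>Contractive semigroups and continuity in the index\<close>

lemma contractive_C0_semigroup_norm_le:
  assumes "contractive_C0_semigroup T" "t \<ge> 0"
  shows "norm (T t x) \<le> norm x"
proof -
  have "norm (T t x) \<le> norm (T t) * norm x"
    by (rule norm_blinfun)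
  also have "\<dots> \<le> 1 * norm x"
    using assms by (intro mult_right_mono) (auto simp: contractive_C0_semigroup_def)
  finally show ?thesis by simp
qed

lemma contractive_C0_semigroup_dist_le:
  assumes "contractive_C0_semigroup T" "t \<ge> 0"
  shows "dist (T t x) (T t y) \<le> dist x y"
  using contractive_C0_semigroup_norm_le[OF assms, of "x - y"]
  by (simp add: dist_norm blinfun.diff_right)

text \<open>
  Contractivity bounds the set under the supremum, so that smallness of the supremum bounds its
  members. The punctured neighbourhood in the definition may be completed, since the difference
  vanishes at \<open>\<omega>\<^sub>0\<close>.
\<close>

lemma kSOT_continuous_eventually:
  fixes T :: "'w::topological_space \<Rightarrow> real \<Rightarrow> 'e::real_normed_vector \<Rightarrow>\<^sub>L 'e"
  assumes T: "\<And>\<omega>. contractive_C0_semigroup (T \<omega>)" and k: "kSOT_continuous T"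
    and K: "compact K" "K \<subseteq> {0..}" and e: "e > 0"
  shows "eventually (\<lambda>\<omega>. \<forall>t\<in>K. dist (T \<omega> t \<xi>) (T \<omega>0 t \<xi>) < e) (nhds \<omega>0)"
proof (cases "K = {}")
  case False
  let ?N = "\<lambda>\<omega> t. norm ((T \<omega> t - T \<omega>0 t) \<xi>)"
  have "((\<lambda>\<omega>. SUP t\<in>K. ?N \<omega> t) \<longlongrightarrow> 0) (at \<omega>0)"
    using k K False unfolding kSOT_continuous_def by blast
  then have "eventually (\<lambda>\<omega>. (SUP t\<in>K. ?N \<omega> t) < e) (at \<omega>0)"
    using e by (rule order_tendstoD(2))
  moreover have "dist (T \<omega> t \<xi>) (T \<omega>0 t \<xi>) < e"
    if "(SUP t\<in>K. ?N \<omega> t) < e" "t \<in> K" for \<omega> t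
  proof -
    have "?N \<omega> s \<le> norm \<xi> + norm \<xi>" if "s \<in> K" for s
      unfolding blinfun.diff_left using that K
      by (intro norm_triangle_le_diff add_mono contractive_C0_semigroup_norm_le T) auto
    then have "bdd_above (?N \<omega> ` K)"
      by (intro bdd_aboveI2)
    then have "?N \<omega> t \<le> (SUP t\<in>K. ?N \<omega> t)"
      using that by (intro cSUP_upper)
    then show ?thesis
      using that by (simp add: dist_norm blinfun.diff_left)
  qed
  ultimately show ?thesis
    using e by (auto simp: eventually_at_filter elim!: eventually_mono)
qed simp

lemma intertwines_iff:
  "intertwines T S \<longleftrightarrow> (\<forall>\<omega>. \<forall>t\<ge>0. \<forall>f. apply_bcontfun (S t f) \<omega> = T \<omega> t (apply_bcontfun f \<omega>))"
  by (auto simp: intertwines_def point_eval.rep_eq dest: arg_cong[where f = blinfun_apply] fun_cong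
      intro!: blinfun_eqI) (metis blinfun_apply_blinfun_compose point_eval.rep_eq)

section \<open>From the semigroup on functions to continuity in the index\<close>

text \<open>
  One direction of the Arzela-Ascoli theorem: a compact set of functions is approximated in the
  supremum norm by finitely many of its members, and finitely many continuous functions share a
  neighbourhood on which they vary little.
\<close>

lemma compact_bcontfun_equicontinuous:
  fixes F :: "('w::topological_space \<Rightarrow>\<^sub>C 'e::metric_space) set"
  assumes "compact F" "e > 0"
  shows "eventually (\<lambda>\<omega>. \<forall>f\<in>F. dist (apply_bcontfun f \<omega>) (apply_bcontfun f \<omega>0) < e) (nhds \<omega>0)"
proof -
  obtain G where G: "finite G" "F \<subseteq> (\<Union>g\<in>G. ball g (e/3))"
    using \<open>compact F\<close> \<open>e > 0\<close> unfolding compact_eq_totally_bounded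
    by (meson divide_pos_pos zero_less_numeral)
  have "eventually (\<lambda>\<omega>. dist (apply_bcontfun g \<omega>) (apply_bcontfun g \<omega>0) < e/3) (nhds \<omega>0)" for g :: "'w \<Rightarrow>\<^sub>C 'e"
  proof -
    have "(apply_bcontfun g \<longlongrightarrow> apply_bcontfun g \<omega>0) (nhds \<omega>0)"
      using continuous_on_apply_bcontfun[of UNIV g]
      by (simp add: continuous_on_def flip: tendsto_at_iff_tendsto_nhds)
    then show ?thesis
      using \<open>e > 0\<close> by (intro tendstoD) auto
  qed
  then have "eventually (\<lambda>\<omega>. \<forall>g\<in>G. dist (apply_bcontfun g \<omega>) (apply_bcontfun g \<omega>0) < e/3) (nhds \<omega>0)"
    using G(1) by (simp add: eventually_ball_finite_distrib)
  then show ?thesis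
  proof eventually_elim
    case (elim \<omega>)
    show ?case
    proof
      fix f assume "f \<in> F"
      then obtain g where g: "g \<in> G" "dist g f < e/3"
        using G(2) by auto
      have "dist (apply_bcontfun g x) (apply_bcontfun f x) < e/3" for x
        using dist_bounded[of g x f] g(2) by linarith
      from this[of \<omega>] this[of \<omega>0] elim[rule_format, OF g(1)]
      show "dist (apply_bcontfun f \<omega>) (apply_bcontfun f \<omega>0) < e"
        by metric
    qed
  qed
qed

text \<open>
  Continuity of \<open>T\<close> in the index is equicontinuity, for \<open>t\<close> in \<open>K\<close>, of the orbit of a constant
  function.
\<close>

lemma intertwines_imp_kSOT_continuous:
  fixes T :: "'w::topological_space \<Rightarrow> real \<Rightarrow> 'e::real_normed_vector \<Rightarrow>\<^sub>L 'e"
  assumes S: "C0_semigroup S" and TS: "intertwines T S"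
  shows "kSOT_continuous T"
  unfolding kSOT_continuous_def
proof (intro allI impI)
  fix \<omega>0 K \<xi> assume K: "compact K \<and> K \<noteq> {} \<and> K \<subseteq> {0::real..}"
  let ?F = "(\<lambda>t. S t (const_bcontfun \<xi>)) ` K"
  have "compact ?F"
    using S K unfolding C0_semigroup_def
    by (intro compact_continuous_image) (auto intro: continuous_on_subset)
  have orbit: "apply_bcontfun (S t (const_bcontfun \<xi>)) \<omega> = T \<omega> t \<xi>" if "t \<in> K" for t \<omega>
    using TS K that by (auto simp: intertwines_iff)
  show "((\<lambda>\<omega>. SUP t\<in>K. norm ((T \<omega> t - T \<omega>0 t) \<xi>)) \<longlongrightarrow> 0) (at \<omega>0)"
  proof (rule tendstoI)
    fix e :: real assume "e > 0"
    then have "eventually (\<lambda>\<omega>. \<forall>f\<in>?F. dist (apply_bcontfun f \<omega>) (apply_bcontfun f \<omega>0) < e/2) (nhds \<omega>0)"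
      by (intro compact_bcontfun_equicontinuous \<open>compact ?F\<close>) auto
    then have "eventually (\<lambda>\<omega>. \<forall>t\<in>K. norm ((T \<omega> t - T \<omega>0 t) \<xi>) < e/2) (at \<omega>0)"
      by (auto simp: eventually_at_filter orbit dist_norm blinfun.diff_left elim!: eventually_mono)
    then show "eventually (\<lambda>\<omega>. dist (SUP t\<in>K. norm ((T \<omega> t - T \<omega>0 t) \<xi>)) 0 < e) (at \<omega>0)"
    proof eventually_elim
      case (elim \<omega>)
      have "(SUP t\<in>K. norm ((T \<omega> t - T \<omega>0 t) \<xi>)) \<le> e/2"
        using elim K by (intro cSUP_least) auto
      moreover have "0 \<le> (SUP t\<in>K. norm ((T \<omega> t - T \<omega>0 t) \<xi>))"
      proof -
        obtain t where "t \<in> K"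
          using K by blast
        moreover have "bdd_above ((\<lambda>t. norm ((T \<omega> t - T \<omega>0 t) \<xi>)) ` K)"
          using elim by (auto intro!: bdd_aboveI[of _ "e/2"] less_imp_le)
        ultimately show ?thesis
          by (intro cSUP_upper2[of _ _ t]) auto
      qed
      ultimately show ?case
        using \<open>e > 0\<close> by simp
    qed
  qed
qed

section \<open>From continuity in the index to the semigroup on functions\<close>

text \<open>
  This is the only possible \<open>T\<^sub>\<Omega>\<close>. At negative times \<open>T\<close> need not be contractive, so the value
  there is set to 0.
\<close>

definition fibrewise ::
    "('w::topological_space \<Rightarrow> real \<Rightarrow> 'e::real_normed_vector \<Rightarrow>\<^sub>L 'e) \<Rightarrow>
     real \<Rightarrow> ('w \<Rightarrow>\<^sub>C 'e) \<Rightarrow>\<^sub>L ('w \<Rightarrow>\<^sub>C 'e)" where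
  "fibrewise T t =
     (if t \<ge> 0 then Blinfun (\<lambda>f. Bcontfun (\<lambda>\<omega>. T \<omega> t (apply_bcontfun f \<omega>))) else 0)"

lemma fibrewise_continuous:
  fixes T :: "'w::topological_space \<Rightarrow> real \<Rightarrow> 'e::real_normed_vector \<Rightarrow>\<^sub>L 'e"
  assumes T: "\<And>\<omega>. contractive_C0_semigroup (T \<omega>)" and k: "kSOT_continuous T" and t: "t \<ge> 0"
  shows "continuous_on UNIV (\<lambda>\<omega>. T \<omega> t (apply_bcontfun f \<omega>))"
proof -
  have "((\<lambda>\<omega>. T \<omega> t (apply_bcontfun f \<omega>)) \<longlongrightarrow> T \<omega>0 t (apply_bcontfun f \<omega>0)) (at \<omega>0)" for \<omega>0
  proof (rule tendstoI)
    fix e :: real assume "e > 0"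
    then have "eventually (\<lambda>\<omega>. \<forall>s\<in>{t}. dist (T \<omega> s (apply_bcontfun f \<omega>0)) (T \<omega>0 s (apply_bcontfun f \<omega>0)) < e/2) (nhds \<omega>0)"
      using t by (intro kSOT_continuous_eventually T k) auto
    moreover have "eventually (\<lambda>\<omega>. \<forall>g\<in>{f}. dist (apply_bcontfun g \<omega>) (apply_bcontfun g \<omega>0) < e/2) (nhds \<omega>0)"
      using \<open>e > 0\<close> by (intro compact_bcontfun_equicontinuous) auto
    ultimately have "eventually (\<lambda>\<omega>. dist (T \<omega> t (apply_bcontfun f \<omega>)) (T \<omega>0 t (apply_bcontfun f \<omega>0)) < e) (nhds \<omega>0)"
    proof eventually_elim
      case (elim \<omega>)
      have "dist (T \<omega> t (apply_bcontfun f \<omega>)) (T \<omega> t (apply_bcontfun f \<omega>0)) < e/2"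
        using contractive_C0_semigroup_dist_le[OF T t] elim(2) by (meson le_less_trans singletonI)
      moreover have "dist (T \<omega> t (apply_bcontfun f \<omega>0)) (T \<omega>0 t (apply_bcontfun f \<omega>0)) < e/2"
        using elim(1) by simp
      ultimately show ?case
        by metric
    qed
    then show "eventually (\<lambda>\<omega>. dist (T \<omega> t (apply_bcontfun f \<omega>)) (T \<omega>0 t (apply_bcontfun f \<omega>0)) < e) (at \<omega>0)"
      by (auto simp: eventually_at_filter elim: eventually_mono)
  qed
  then show ?thesis
    by (simp add: continuous_on_def)
qed

context
  fixes T :: "'w::topological_space \<Rightarrow> real \<Rightarrow> 'e::real_normed_vector \<Rightarrow>\<^sub>L 'e"
  assumes T: "\<And>\<omega>. contractive_C0_semigroup (T \<omega>)" and k: "kSOT_continuous T"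
begin

lemma norm_fibre_le:
  assumes "t \<ge> 0"
  shows "norm (T \<omega> t (apply_bcontfun f \<omega>)) \<le> norm f"
  using contractive_C0_semigroup_norm_le[OF T assms] norm_bounded by (rule order_trans)

lemma fibrewise_bcontfun:
  assumes "t \<ge> 0"
  shows "(\<lambda>\<omega>. T \<omega> t (apply_bcontfun f \<omega>)) \<in> bcontfun"
  using fibrewise_continuous[OF T k assms] norm_fibre_le[OF assms] by (rule bcontfun_normI)

lemma apply_fibrewise:
  assumes "t \<ge> 0"
  shows "apply_bcontfun (fibrewise T t f) \<omega> = T \<omega> t (apply_bcontfun f \<omega>)"
proof -
  define A where "A = (\<lambda>f. Bcontfun (\<lambda>\<omega>. T \<omega> t (apply_bcontfun f \<omega>)))"
  have A: "apply_bcontfun (A f) \<omega> = T \<omega> t (apply_bcontfun f \<omega>)" for f \<omega>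
    using fibrewise_bcontfun[OF assms] by (simp add: A_def Bcontfun_inverse)
  have "bounded_linear A"
  proof (rule bounded_linear_intro[where K = 1])
    show "norm (A f) \<le> norm f * 1" for f
      by (auto intro!: norm_bound simp: A norm_fibre_le[OF assms])
    show "A (f + g) = A f + A g" for f g
      by (rule bcontfun_eqI) (simp add: A blinfun.add_right)
    show "A (r *\<^sub>R f) = r *\<^sub>R A f" for r f
      by (rule bcontfun_eqI) (simp add: A blinfun.scaleR_right)
  qed
  then show ?thesis
    using assms by (simp add: fibrewise_def A_def[symmetric] bounded_linear_Blinfun_apply A)
qed

text \<open>
  Near each \<open>\<omega>\<^sub>0\<close> the orbits \<open>t \<mapsto> T \<omega> t (f \<omega>)\<close> follow, uniformly for \<open>t\<close> up to \<open>t0 + 1\<close>, the single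
  orbit of \<open>f \<omega>\<^sub>0\<close> under \<open>T \<omega>\<^sub>0\<close>, so one \<open>\<delta>\<close> in the time variable serves a whole
  neighbourhood of \<open>\<omega>\<^sub>0\<close>; compactness of \<open>\<Omega>\<close> leaves finitely many \<open>\<delta>\<close> to intersect.
\<close>

lemma fibrewise_strongly_continuous:
  assumes cpt: "compact (UNIV :: 'w set)"
  shows "continuous_on {0..} (\<lambda>t. fibrewise T t f)"
  unfolding continuous_on_def
proof (intro ballI tendstoI)
  fix t0 e :: real assume t0: "t0 \<in> {0..}" and e: "e > 0"
  let ?near = "\<lambda>t. dist (fibrewise T t f) (fibrewise T t0 f)"
  let ?U = "\<lambda>P \<omega>0. open P \<and> \<omega>0 \<in> P \<and>
    eventually (\<lambda>t. \<forall>\<omega>\<in>P. dist (T \<omega> t (apply_bcontfun f \<omega>)) (T \<omega> t0 (apply_bcontfun f \<omega>)) < e/2) (at t0 within {0..})"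
  have "\<exists>P. ?U P \<omega>0" for \<omega>0
  proof -
    let ?x = "apply_bcontfun f \<omega>0"
    define K where "K = {0..t0+1}"
    have "eventually (\<lambda>\<omega>. \<forall>t\<in>K. dist (T \<omega> t ?x) (T \<omega>0 t ?x) < e/10) (nhds \<omega>0)"
      using e by (intro kSOT_continuous_eventually T k) (auto simp: K_def)
    moreover have "eventually (\<lambda>\<omega>. \<forall>g\<in>{f}. dist (apply_bcontfun g \<omega>) (apply_bcontfun g \<omega>0) < e/10) (nhds \<omega>0)"
      using e by (intro compact_bcontfun_equicontinuous) auto
    ultimately have "eventually (\<lambda>\<omega>. \<forall>t\<in>K. dist (T \<omega> t (apply_bcontfun f \<omega>)) (T \<omega>0 t ?x) < e/5) (nhds \<omega>0)"
    proof eventually_elim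
      case (elim \<omega>)
      show ?case
      proof
        fix t assume "t \<in> K"
        then have "dist (T \<omega> t (apply_bcontfun f \<omega>)) (T \<omega> t ?x) < e/10"
          using elim(2) contractive_C0_semigroup_dist_le[OF T, of t \<omega> "apply_bcontfun f \<omega>" ?x]
          by (simp add: K_def)
        moreover have "dist (T \<omega> t ?x) (T \<omega>0 t ?x) < e/10"
          using elim(1) \<open>t \<in> K\<close> by blast
        ultimately show "dist (T \<omega> t (apply_bcontfun f \<omega>)) (T \<omega>0 t ?x) < e/5"
          by metric
      qed
    qed
    then obtain P where P: "open P" "\<omega>0 \<in> P"
        "\<And>\<omega> t. \<omega> \<in> P \<Longrightarrow> t \<in> K \<Longrightarrow> dist (T \<omega> t (apply_bcontfun f \<omega>)) (T \<omega>0 t ?x) < e/5"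
      unfolding eventually_nhds by blast
    have "((\<lambda>t. T \<omega>0 t ?x) \<longlongrightarrow> T \<omega>0 t0 ?x) (at t0 within {0..})"
      using T t0 by (auto simp: contractive_C0_semigroup_def C0_semigroup_def continuous_on_def)
    then have "eventually (\<lambda>t. dist (T \<omega>0 t ?x) (T \<omega>0 t0 ?x) < e/10) (at t0 within {0..})"
      by (rule tendstoD) (use e in auto)
    moreover have "eventually (\<lambda>t. t \<in> K) (at t0 within {0..})"
      using t0 unfolding eventually_at K_def by (intro exI[of _ 1]) (auto simp: dist_real_def)
    ultimately have "eventually (\<lambda>t. \<forall>\<omega>\<in>P. dist (T \<omega> t (apply_bcontfun f \<omega>)) (T \<omega> t0 (apply_bcontfun f \<omega>)) < e/2) (at t0 within {0..})"
    proof eventually_elim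
      case (elim t)
      have "t0 \<in> K"
        using t0 by (simp add: K_def)
      show ?case
      proof
        fix \<omega> assume "\<omega> \<in> P"
        from P(3)[OF this \<open>t \<in> K\<close>] P(3)[OF this \<open>t0 \<in> K\<close>] elim(1)
        show "dist (T \<omega> t (apply_bcontfun f \<omega>)) (T \<omega> t0 (apply_bcontfun f \<omega>)) < e/2"
          by metric
      qed
    qed
    with P show ?thesis by blast
  qed
  then have "\<forall>\<omega>0. \<exists>P. ?U P \<omega>0" ..
  from choice[OF this] obtain P where P: "\<forall>\<omega>0. ?U (P \<omega>0) \<omega>0" ..
  then have "\<And>\<omega>. open (P \<omega>)" "\<And>\<omega>. \<omega> \<in> P \<omega>"
    by simp_all
  then obtain D where D: "finite D" "UNIV \<subseteq> (\<Union>\<omega>0\<in>D. P \<omega>0)"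
    using compactE_image[OF cpt, of UNIV P] by (metis UNIV_I UN_I subsetI)
  have "eventually (\<lambda>t. \<forall>\<omega>0\<in>D. \<forall>\<omega>\<in>P \<omega>0. dist (T \<omega> t (apply_bcontfun f \<omega>)) (T \<omega> t0 (apply_bcontfun f \<omega>)) < e/2) (at t0 within {0..})"
    using P D(1) by (simp add: eventually_ball_finite_distrib)
  moreover have "eventually (\<lambda>t. t \<in> {0..}) (at t0 within {0..})"
    by (simp add: eventually_at_filter)
  ultimately show "eventually (\<lambda>t. ?near t < e) (at t0 within {0..})"
  proof eventually_elim
    case (elim t)
    have "?near t \<le> e/2"
    proof (rule dist_bound)
      fix \<omega>
      obtain \<omega>0 where "\<omega>0 \<in> D" "\<omega> \<in> P \<omega>0"
        using D(2) by blast
      then show "dist (apply_bcontfun (fibrewise T t f) \<omega>) (apply_bcontfun (fibrewise T t0 f) \<omega>) \<le> e/2"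
        using elim t0 by (auto simp: apply_fibrewise intro: less_imp_le)
    qed
    with e show ?case by simp
  qed
qed

lemma contractive_C0_semigroup_fibrewise:
  assumes "compact (UNIV :: 'w set)"
  shows "contractive_C0_semigroup (fibrewise T)"
  unfolding contractive_C0_semigroup_def C0_semigroup_def
proof (intro conjI allI impI)
  have T0: "T \<omega> 0 = id_blinfun" for \<omega>
    using T by (simp add: contractive_C0_semigroup_def C0_semigroup_def)
  show "fibrewise T 0 = id_blinfun"
    by (intro blinfun_eqI bcontfun_eqI) (simp add: apply_fibrewise T0)
  have Tadd: "T \<omega> (s + t) = T \<omega> s o\<^sub>L T \<omega> t" if "s \<ge> 0" "t \<ge> 0" for \<omega> s t
    using T that by (simp add: contractive_C0_semigroup_def C0_semigroup_def)
  show "fibrewise T (s + t) = fibrewise T s o\<^sub>L fibrewise T t" if "s \<ge> 0" "t \<ge> 0" for s t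
    using that by (intro blinfun_eqI bcontfun_eqI) (simp add: apply_fibrewise Tadd)
  show "continuous_on {0..} (\<lambda>t. fibrewise T t f)" for f
    by (rule fibrewise_strongly_continuous[OF assms])
  show "norm (fibrewise T t) \<le> 1" if "t \<ge> 0" for t
  proof (rule norm_blinfun_bound)
    show "norm (fibrewise T t f) \<le> 1 * norm f" for f
      by (auto intro!: norm_bound simp: apply_fibrewise that norm_fibre_le)
  qed simp
qed

lemma intertwines_fibrewise: "intertwines T (fibrewise T)"
  by (simp add: intertwines_iff apply_fibrewise)

end

section \<open>The characterisation\<close>

theorem proposition3p13:
  fixes T :: "'w::topological_space \<Rightarrow> real \<Rightarrow> 'e::banach \<Rightarrow>\<^sub>L 'e"
  assumes "compact (UNIV :: 'w set)"
    and "\<And>\<omega>. contractive_C0_semigroup (T \<omega>)"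
  shows "(kSOT_continuous T \<longleftrightarrow>
            (\<exists>S. contractive_C0_semigroup S \<and> intertwines T S)) \<and>
         (\<forall>S S'. contractive_C0_semigroup S \<and> intertwines T S \<and>
                 contractive_C0_semigroup S' \<and> intertwines T S' \<longrightarrow>
                 (\<forall>t\<ge>0. S t = S' t)) \<and>
         (\<forall>S. contractive_C0_semigroup S \<and> intertwines T S \<longrightarrow>
              (\<forall>\<omega>. \<forall>t\<ge>0. point_eval \<omega> o\<^sub>L S t o\<^sub>L const_embedding = T \<omega> t))"
proof (intro conjI iffI allI impI)
  assume "kSOT_continuous T"
  then show "\<exists>S. contractive_C0_semigroup S \<and> intertwines T S"
    using contractive_C0_semigroup_fibrewise[of T] intertwines_fibrewise[of T] assms by blast
next
  assume "\<exists>S. contractive_C0_semigroup S \<and> intertwines T S"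
  then show "kSOT_continuous T"
    by (auto simp: contractive_C0_semigroup_def intro: intertwines_imp_kSOT_continuous)
next
  fix S S' and t :: real
  assume "contractive_C0_semigroup S \<and> intertwines T S \<and>
          contractive_C0_semigroup S' \<and> intertwines T S'" "t \<ge> 0"
  then show "S t = S' t"
    by (intro blinfun_eqI bcontfun_eqI) (simp add: intertwines_iff)
next
  fix S \<omega> and t :: real
  assume "contractive_C0_semigroup S \<and> intertwines T S" "t \<ge> 0"
  then show "point_eval \<omega> o\<^sub>L S t o\<^sub>L const_embedding = T \<omega> t"
    by (intro blinfun_eqI) (simp add: intertwines_iff point_eval.rep_eq const_embedding.rep_eq)
qed

end
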